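(* Let $s<n$ be integers, $X\subseteq\mathbb{R}^n$ closed and convex, $f:\mathbb{R}^n\to\mathbb{R}$ continuously differentiable with Lipschitz continuous gradient on $\mathbb{R}^n$. Let $\{(x^k,y^k)\}$ be the sequence generated by Algorithm SNS equipped with $\mathcal{N}_\rho$ as neighborhood, started from $y^0\in\mathcal{Y}$, $x^0\in\mathcal{X}(y^0)$ with parameter $\xi>0$, and suppose that the level set $\{(x,y): y\in\mathcal{Y},\ x\in\mathcal{X}(y),\ f(x)\le f(x^0)+\xi\}$ is compact. Let $K_u=\{k\ge1:\eta_k<\eta_{k-1}\}$, let $\mathcal{A}^*$ be the set of accumulation points of $\{(x^k,y^k)\}_{k\in K_u}$, and let $\delta^*=\min\{\|x^*\|_0 : (x^*,y^* )\in\mathcal{A}^*\}$. If $\rho\ge 2(s-\delta^* )$, then for every $(x^*,y^* )\in\mathcal{A}^*$ the point $x^*$ is basic feasible for the problem $\min\{f(x):\|x\|_0\le s,\ x\in X\}$.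
   Context: $\|x\|_0$ is the number of nonzero components of $x$, $e$ is the all-ones vector, $\Pi_C$ is the Euclidean projection onto a nonempty closed convex set $C$. Put $\mathcal{Y}=\{y\in\{0,1\}^n : e^\top y\ge n-s\}$ and $\mathcal{X}(y)=\{x\in X : x_iy_i=0\ \forall i\}$ for $y\in\mathcal{Y}$ (closed and convex). A pair $(x,y)$ is feasible if $y\in\mathcal{Y}$ and $x\in\mathcal{X}(y)$. A sequence $(x^k,y^k)$ converges to $(\bar x,\bar y)$ if $x^k\to\bar x$ and $y^k=\bar y$ for all sufficiently large $k$; accumulation points are limits of convergent subsequences. Basic feasibility: a super support of $x^*$ (where $x^*\in X$, $\|x^*\|_0\le s$) is a set $J\subset\{1,\dots,n\}$ with $|J|=s$ and $\{i:x^*_i\ne0\}\subseteq J$. The point $x^*$ is basic feasible if for any super support $J$ of $x^*$, letting $y_J\in\{0,1\}^n$ have components $0$ for $i\in J$ and $1$ otherwise, there exists $L>0$ such that $x^*=\Pi_{\mathcal{X}(y_J)}(x^*+d)$, where $d_i=-\frac1L\nabla_if(x^* )$ for $i\in J$ and $d_i=0$ otherwise. Neighborhood $\mathcal{N}_\rho$ ($\rho\in\mathbb{N}$): let $d_H$ be the Hamming distance on $\{0,1\}^n$, $J(y,\hat y)=\{i: y_i\ne\hat y_i\}$, and let $H_{J(y,\hat y)}(x)$ be obtained from $x$ by setting to $0$ all components with index in $J(y,\hat y)$. For a feasible pair $(x,y)$, $\mathcal{N}_\rho(x,y)$ is the set of pairs $(\hat x,\hat y)$ with $\hat y\in\mathcal{Y}$,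 $\mathcal{X}(\hat y)\ne\emptyset$, $d_H(\hat y,y)\le\rho$ and $\hat x=\Pi_{\mathcal{X}(\hat y)}\big(H_{J(y,\hat y)}(x)\big)$ (when $X=\mathbb{R}^n$ the projection leaves the point unchanged). Procedure PGLS$(x,y)$ (fixed constants $\gamma\in(0,\tfrac12)$, $\delta\in(0,1)$): for a feasible pair $(x,y)$ set $d=\Pi_{\mathcal{X}(y)}[x-\nabla f(x)]-x$; let $\alpha$ be the first element of $1,\delta,\delta^2,\dots$ with $f(x+\alpha d)\le f(x)+\gamma\alpha\nabla f(x)^\top d$; return $\tilde x=x+\alpha d$. Algorithm SNS (with neighborhood $\mathcal{N}$; here $\mathcal{N}=\mathcal{N}_\rho$). Inputs: $y^0\in\mathcal{Y}$, $x^0\in\mathcal{X}(y^0)$, $\xi>0$, $\theta\in(0,1)$, $\eta_0>0$, $\mu_0>0$, $\delta'\in(0,1)$. For $k=0,1,2,\dots$ (no stopping rule): Step 1: compute $\tilde x^k$ by PGLS$(x^k,y^k)$. Step 2: let $W_k=\{(x,y)\in\mathcal{N}(\tilde x^k,y^k): f(x)\le f(\tilde x^k)+\xi\}$. 2.1: if $W_k\ne\emptyset$, choose any $(x',y')\in W_k$, set $j=1$, $x^j=x'$ (inner iterates); otherwise go to Step 3. 2.2: compute $x^{j+1}$ by PGLS$(x^j,y')$. 2.3: if $f(x^{j+1})\le f(\tilde x^k)-\eta_k$, set $x^{k+1}=x^{j+1}$, $y^{k+1}=y'$, $\eta_{k+1}=\eta_k$ and go to Step 4. 2.4: if $\|x^j-\Pi_{\mathcal{X}(y')}[x^j-\nabla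 f(x^j)]\|>\|x^k-\Pi_{\mathcal{X}(y^k)}[x^k-\nabla f(x^k)]\|+\mu_k$, set $j=j+1$ and go to 2.2; otherwise remove $(x',y')$ from $W_k$ and go to 2.1. Step 3: set $x^{k+1}=\tilde x^k$, $y^{k+1}=y^k$; if $f(x^{k+1})\le f(x^k)-\eta_k$ set $\eta_{k+1}=\eta_k$, otherwise $\eta_{k+1}=\theta\eta_k$. Step 4: set $\mu_{k+1}=\delta'\mu_k$ and pass to iteration $k+1$. *)

theory Defs
  imports "HOL-Analysis.Analysis"
begin

definition gradient :: "('a::real_inner \<Rightarrow> real) \<Rightarrow> 'a \<Rightarrow> 'a" where
  "gradient f x = (THE D. GDERIV f x :> D)"

lemma gradient_eqI:
  fixes f :: "'a::real_inner \<Rightarrow> real"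
  assumes "GDERIV f x :> D"
  shows "gradient f x = D"
  unfolding gradient_def
proof (rule the_equality[where P = "\<lambda>D. GDERIV f x :> D", OF assms])
  fix E assume "GDERIV f x :> E"
  then have "(\<lambda>h. inner h E) = (\<lambda>h. inner h D)"
    using assms unfolding gderiv_def by (rule has_derivative_unique)
  then have "inner (E - D) E = inner (E - D) D" by (rule fun_cong)
  then have "inner (E - D) (E - D) = 0" by (simp add: inner_diff_right)
  then show "E = D" by simp
qed

lemma GDERIV_gradient:
  fixes f :: "'a::euclidean_space \<Rightarrow> real"
  assumes "f differentiable (at x)"
  shows "GDERIV f x :> gradient f x"
proof -
  obtain f' where f': "(f has_derivative f') (at x)"
    using assms unfolding differentiable_def by blast
  then have "linear f'" by (rule has_derivative_linear)
  then have "f' = (\<lambda>h. inner h (adjoint f' 1))"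
    by (auto simp: adjoint_works)
  then have "GDERIV f x :> adjoint f' 1"
    using f' unfolding gderiv_def by simp
  then show ?thesis using gradient_eqI by metis
qed

definition norm0 :: "real ^ 'n \<Rightarrow> nat" where
  "norm0 x = card {i. x $ i \<noteq> 0}"

text \<open>The set \<open>\<Y>\<close>; binary vectors are embedded in Euclidean space.\<close>
definition Yset :: "nat \<Rightarrow> (real ^ 'n) set" where
  "Yset s = {y. (\<forall>i. y $ i \<in> {0, 1}) \<and> 1 \<bullet> y \<ge> real CARD('n) - real s}"

text \<open>The set \<open>\<X>(y)\<close>.\<close>
definition Xset :: "(real ^ 'n) set \<Rightarrow> real ^ 'n \<Rightarrow> (real ^ 'n) set" where
  "Xset X y = {x \<in> X. \<forall>i. x $ i * y $ i = 0}"

definition super_support :: "nat \<Rightarrow> real ^ 'n \<Rightarrow> 'n set \<Rightarrow> bool" where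
  "super_support s x J \<longleftrightarrow> card J = s \<and> {i. x $ i \<noteq> 0} \<subseteq> J"

definition basic_feasible ::
    "(real ^ 'n) set \<Rightarrow> nat \<Rightarrow> (real ^ 'n \<Rightarrow> real) \<Rightarrow> real ^ 'n \<Rightarrow> bool" where
  "basic_feasible X s f x \<longleftrightarrow>
     x \<in> X \<and> norm0 x \<le> s \<and>
     (\<forall>J. super_support s x J \<longrightarrow>
        (\<exists>L>0. x = closest_point (Xset X (\<chi> i. if i \<in> J then 0 else 1))
                     (x + (\<chi> i. if i \<in> J then - (1 / L) * gradient f x $ i else 0))))"

definition diff_indices :: "real ^ 'n \<Rightarrow> real ^ 'n \<Rightarrow> 'n set" where
  "diff_indices y y' = {i. y $ i \<noteq> y' $ i}"

definition hamming_dist :: "real ^ 'n \<Rightarrow> real ^ 'n \<Rightarrow> nat" where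
  "hamming_dist y y' = card (diff_indices y y')"

definition zero_out :: "'n set \<Rightarrow> real ^ 'n \<Rightarrow> real ^ 'n" where
  "zero_out J x = (\<chi> i. if i \<in> J then 0 else x $ i)"

definition neighborhood ::
    "(real ^ 'n) set \<Rightarrow> nat \<Rightarrow> nat \<Rightarrow> real ^ 'n \<Rightarrow> real ^ 'n \<Rightarrow> ((real ^ 'n) \<times> (real ^ 'n)) set" where
  "neighborhood X s \<rho> x y =
     {(x', y'). y' \<in> Yset s \<and> Xset X y' \<noteq> {} \<and> hamming_dist y' y \<le> \<rho> \<and>
                x' = closest_point (Xset X y') (zero_out (diff_indices y y') x)}"

definition pg_direction ::
    "(real ^ 'n) set \<Rightarrow> (real ^ 'n \<Rightarrow> real) \<Rightarrow> real ^ 'n \<Rightarrow> real ^ 'n \<Rightarrow> real ^ 'n" where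
  "pg_direction X f x y = closest_point (Xset X y) (x - gradient f x) - x"

definition residual ::
    "(real ^ 'n) set \<Rightarrow> (real ^ 'n \<Rightarrow> real) \<Rightarrow> real ^ 'n \<Rightarrow> real ^ 'n \<Rightarrow> real" where
  "residual X f x y = norm (x - closest_point (Xset X y) (x - gradient f x))"

text \<open>Projected gradient step with Armijo backtracking over \<open>1, \<delta>, \<delta>\<^sup>2, \<dots>\<close>.\<close>
definition pgls ::
    "(real ^ 'n) set \<Rightarrow> (real ^ 'n \<Rightarrow> real) \<Rightarrow> real \<Rightarrow> real \<Rightarrow> real ^ 'n \<Rightarrow> real ^ 'n \<Rightarrow> real ^ 'n" where
  "pgls X f \<gamma> \<delta> x y =
     (let d = pg_direction X f x y;
          m = (LEAST m. f (x + \<delta> ^ m *\<^sub>R d) \<le> f x + \<gamma> * \<delta> ^ m * (gradient f x \<bullet> d))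
      in x + \<delta> ^ m *\<^sub>R d)"

text \<open>
  Steps 2.2 to 2.4 from the inner iterate \<open>z\<close>, with \<open>target = f(x\<tilde>\<^sup>k) - \<eta>\<^sub>k\<close> and \<open>tol\<close> the
  right-hand side of the test in Step 2.4. The outcome \<open>Some z'\<close> means that \<open>z'\<close> is accepted
  as the next outer iterate in Step 2.3, \<open>None\<close> that the trial pair is discarded.
  An inner loop that does not terminate has no outcome.
\<close>
inductive inner_search ::
    "(real ^ 'n) set \<Rightarrow> (real ^ 'n \<Rightarrow> real) \<Rightarrow> real \<Rightarrow> real \<Rightarrow> real \<Rightarrow> real \<Rightarrow>
     real ^ 'n \<Rightarrow> real ^ 'n \<Rightarrow> (real ^ 'n) option \<Rightarrow> bool"
  for X f \<gamma> \<delta> target tol y' where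
  accept:
    "f (pgls X f \<gamma> \<delta> z y') \<le> target \<Longrightarrow>
     inner_search X f \<gamma> \<delta> target tol y' z (Some (pgls X f \<gamma> \<delta> z y'))"
| discard:
    "\<not> f (pgls X f \<gamma> \<delta> z y') \<le> target \<Longrightarrow> \<not> residual X f z y' > tol \<Longrightarrow>
     inner_search X f \<gamma> \<delta> target tol y' z None"
| continue:
    "\<not> f (pgls X f \<gamma> \<delta> z y') \<le> target \<Longrightarrow> residual X f z y' > tol \<Longrightarrow>
     inner_search X f \<gamma> \<delta> target tol y' (pgls X f \<gamma> \<delta> z y') out \<Longrightarrow>
     inner_search X f \<gamma> \<delta> target tol y' z out"

text \<open>
  The whole of Step 2 on a set of trial pairs, examined in an arbitrary order. The outcome \<open>None\<close>
  means that all pairs have been discarded, so that Step 3 is reached.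
\<close>
inductive explore ::
    "(real ^ 'n) set \<Rightarrow> (real ^ 'n \<Rightarrow> real) \<Rightarrow> real \<Rightarrow> real \<Rightarrow> real \<Rightarrow> real \<Rightarrow>
     ((real ^ 'n) \<times> (real ^ 'n)) set \<Rightarrow> ((real ^ 'n) \<times> (real ^ 'n)) option \<Rightarrow> bool"
  for X f \<gamma> \<delta> target tol where
  exhausted:
    "explore X f \<gamma> \<delta> target tol {} None"
| success:
    "(x', y') \<in> W \<Longrightarrow> inner_search X f \<gamma> \<delta> target tol y' x' (Some z) \<Longrightarrow>
     explore X f \<gamma> \<delta> target tol W (Some (z, y'))"
| remove:
    "(x', y') \<in> W \<Longrightarrow> inner_search X f \<gamma> \<delta> target tol y' x' None \<Longrightarrow>
     explore X f \<gamma> \<delta> target tol (W - {(x', y')}) out \<Longrightarrow>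
     explore X f \<gamma> \<delta> target tol W out"

definition trial_pairs ::
    "(real ^ 'n) set \<Rightarrow> nat \<Rightarrow> (real ^ 'n \<Rightarrow> real) \<Rightarrow> nat \<Rightarrow> real \<Rightarrow>
     real ^ 'n \<Rightarrow> real ^ 'n \<Rightarrow> ((real ^ 'n) \<times> (real ^ 'n)) set" where
  "trial_pairs X s f \<rho> \<xi> xt y = {(x', y') \<in> neighborhood X s \<rho> xt y. f x' \<le> f xt + \<xi>}"

text \<open>
  \<open>sns_step \<dots> (x, y, \<eta>, \<mu>) (x\<^sub>+, y\<^sub>+, \<eta>\<^sub>+, \<mu>\<^sub>+)\<close>: one outer iteration of the algorithm
  may turn the first state into the second.
\<close>
inductive sns_step ::
    "(real ^ 'n) set \<Rightarrow> nat \<Rightarrow> (real ^ 'n \<Rightarrow> real) \<Rightarrow> real \<Rightarrow> real \<Rightarrow> nat \<Rightarrow> real \<Rightarrow> real \<Rightarrow> real \<Rightarrow>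
     (real ^ 'n) \<times> (real ^ 'n) \<times> real \<times> real \<Rightarrow>
     (real ^ 'n) \<times> (real ^ 'n) \<times> real \<times> real \<Rightarrow> bool"
  for X s f \<gamma> \<delta> \<rho> \<xi> \<theta> \<delta>' where
  improved:
    "xt = pgls X f \<gamma> \<delta> x y \<Longrightarrow>
     explore X f \<gamma> \<delta> (f xt - \<eta>) (residual X f x y + \<mu>)
       (trial_pairs X s f \<rho> \<xi> xt y) (Some (z, y')) \<Longrightarrow>
     sns_step X s f \<gamma> \<delta> \<rho> \<xi> \<theta> \<delta>' (x, y, \<eta>, \<mu>) (z, y', \<eta>, \<delta>' * \<mu>)"
| not_improved:
    "xt = pgls X f \<gamma> \<delta> x y \<Longrightarrow>
     explore X f \<gamma> \<delta> (f xt - \<eta>) (residual X f x y + \<mu>)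
       (trial_pairs X s f \<rho> \<xi> xt y) None \<Longrightarrow>
     sns_step X s f \<gamma> \<delta> \<rho> \<xi> \<theta> \<delta>' (x, y, \<eta>, \<mu>)
       (xt, y, if f xt \<le> f x - \<eta> then \<eta> else \<theta> * \<eta>, \<delta>' * \<mu>)"

definition sns_sequence ::
    "(real ^ 'n) set \<Rightarrow> nat \<Rightarrow> (real ^ 'n \<Rightarrow> real) \<Rightarrow> real \<Rightarrow> real \<Rightarrow> nat \<Rightarrow> real \<Rightarrow> real \<Rightarrow> real \<Rightarrow>
     (nat \<Rightarrow> real ^ 'n) \<Rightarrow> (nat \<Rightarrow> real ^ 'n) \<Rightarrow> (nat \<Rightarrow> real) \<Rightarrow> (nat \<Rightarrow> real) \<Rightarrow> bool" where
  "sns_sequence X s f \<gamma> \<delta> \<rho> \<xi> \<theta> \<delta>' x y \<eta> \<mu> \<longleftrightarrow>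
     (\<forall>k. sns_step X s f \<gamma> \<delta> \<rho> \<xi> \<theta> \<delta>'
            (x k, y k, \<eta> k, \<mu> k) (x (Suc k), y (Suc k), \<eta> (Suc k), \<mu> (Suc k)))"

text \<open>
  Accumulation points of the subsequence with indices in \<open>K\<close>; convergence of pairs requires
  the second components to be eventually constant. There are none if \<open>K\<close> is finite.
\<close>
definition accumulation_points ::
    "nat set \<Rightarrow> (nat \<Rightarrow> real ^ 'n) \<Rightarrow> (nat \<Rightarrow> real ^ 'n) \<Rightarrow> ((real ^ 'n) \<times> (real ^ 'n)) set" where
  "accumulation_points K x y =
     {(a, b). \<exists>r :: nat \<Rightarrow> nat. strict_mono r \<and> range r \<subseteq> K \<and>
        (\<lambda>m. x (r m)) \<longlonglongrightarrow> a \<and> (\<forall>\<^sub>F m in sequentially. y (r m) = b)}"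

end

theory Submission
  imports Defs
begin

text \<open>
  An index \<open>k + 1\<close> of \<open>Ku\<close> arises only when all trial pairs of iteration \<open>k\<close> have been discarded.
  For a super support \<open>J\<close> of an accumulation point \<open>x*\<close>, the bound on \<open>\<rho>\<close> puts \<open>y\<^sub>J\<close> into the
  neighborhood, and the projected points \<open>p\<^sub>k\<close> belonging to \<open>y\<^sub>J\<close> converge to \<open>x*\<close>. Already the
  first inner step from \<open>p\<^sub>k\<close> was rejected in Step 2.3, so by the Armijo rule it decreases \<open>f\<close> by at
  least a fixed multiple of the squared residual of \<open>p\<^sub>k\<close>, but by less than
  \<open>f(p\<^sub>k) - f(x\<^sub>k\<^sub>+\<^sub>1) + \<eta>\<^sub>k\<close>, which tends to 0. Hence the residual of \<open>x*\<close> on \<open>\<X>(y\<^sub>J)\<close> vanishes,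
  which is basic feasibility with \<open>L = 1\<close>.
\<close>

section \<open>The sets \<open>Xset X y\<close> and sufficient decrease of the projected gradient
  step\<close>

lemma closed_Xset:
  fixes X :: "(real ^ 'n) set"
  assumes "closed X"
  shows "closed (Xset X y)"
proof -
  have "Xset X y = X \<inter> (\<Inter>i. {x. x $ i * y $ i = 0})"
    by (auto simp: Xset_def)
  moreover have "closed {x :: real ^ 'n. x $ i * y $ i = 0}" for i
    by (intro closed_Collect_eq continuous_intros)
  ultimately show ?thesis
    using assms by (simp only:) (intro closed_Int closed_INT ballI)
qed

lemma convex_Xset:
  fixes X :: "(real ^ 'n) set"
  assumes "convex X"
  shows "convex (Xset X y)"
  using assms unfolding convex_def Xset_def
  by auto (metis add_0 mult_zero_right)

text \<open>The obtuse-angle property of the projection of \<open>x - gradient f x\<close>, tested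
  at the feasible point \<open>x\<close> itself.\<close>

lemma pg_direction_descent:
  assumes "closed X" "convex X" "x \<in> Xset X y"
  shows "gradient f x \<bullet> pg_direction X f x y \<le> - (norm (pg_direction X f x y))\<^sup>2"
proof -
  define d where "d = pg_direction X f x y"
  have p: "closest_point (Xset X y) (x - gradient f x) = x + d"
    by (simp add: d_def pg_direction_def)
  have "(x - gradient f x - (x + d)) \<bullet> (x - (x + d)) \<le> 0"
    using closest_point_dot[OF convex_Xset[OF assms(2)] closed_Xset[OF assms(1)] assms(3)] p
    by metis
  then have "gradient f x \<bullet> d + d \<bullet> d \<le> 0"
    by (simp add: algebra_simps)
  then show ?thesis
    by (simp add: d_def power2_norm_eq_inner)
qed

text \<open>The mean value theorem on the segment replaces integration of the gradient. It yields
  \<open>L\<close> instead of the sharp \<open>L / 2\<close>, but any fixed multiple serves the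
  Armijo estimate.\<close>

lemma lipschitz_gradient_bound:
  fixes f :: "'a::euclidean_space \<Rightarrow> real"
  assumes diff: "\<And>z. f differentiable (at z)"
    and lip: "L-lipschitz_on UNIV (gradient f)"
    and "0 < t"
  shows "f (x + t *\<^sub>R d) \<le> f x + t * (gradient f x \<bullet> d) + L * t\<^sup>2 * (norm d)\<^sup>2"
proof -
  have der: "((\<lambda>u. f (x + u *\<^sub>R d)) has_real_derivative (gradient f (x + u *\<^sub>R d) \<bullet> d)) (at u)" for u
  proof -
    have "((\<lambda>u. x + u *\<^sub>R d) has_derivative (\<lambda>h. h *\<^sub>R d)) (at u)"
      by (auto intro!: derivative_eq_intros)
    moreover have "(f has_derivative (\<lambda>h. h \<bullet> gradient f (x + u *\<^sub>R d))) (at (x + u *\<^sub>R d))"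
      using GDERIV_gradient[OF diff] by (simp add: gderiv_def)
    ultimately have "((\<lambda>u. f (x + u *\<^sub>R d)) has_derivative
        (\<lambda>h. (h *\<^sub>R d) \<bullet> gradient f (x + u *\<^sub>R d))) (at u)"
      by (rule has_derivative_compose)
    then show ?thesis
      by (simp add: has_field_derivative_def inner_commute mult_commute_abs)
  qed
  obtain u where u: "0 < u" "u < t"
    and eq: "f (x + t *\<^sub>R d) - f (x + 0 *\<^sub>R d) = (t - 0) * (gradient f (x + u *\<^sub>R d) \<bullet> d)"
    using MVT2[OF \<open>0 < t\<close>, of "\<lambda>u. f (x + u *\<^sub>R d)" "\<lambda>u. gradient f (x + u *\<^sub>R d) \<bullet> d"] der
    by blast
  have L: "0 \<le> L"
    using lip by (rule lipschitz_on_nonneg)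
  have "norm (gradient f (x + u *\<^sub>R d) - gradient f x) \<le> L * norm (u *\<^sub>R d)"
    using lipschitz_onD[OF lip, of "x + u *\<^sub>R d" x] by (simp add: dist_norm)
  also have "\<dots> \<le> L * (t * norm d)"
    using u L by (intro mult_left_mono) (auto intro: mult_right_mono)
  finally have "norm (gradient f (x + u *\<^sub>R d) - gradient f x) * norm d \<le> L * (t * norm d) * norm d"
    by (rule mult_right_mono) simp
  then have "(gradient f (x + u *\<^sub>R d) - gradient f x) \<bullet> d \<le> L * t * (norm d)\<^sup>2"
    using norm_cauchy_schwarz[of "gradient f (x + u *\<^sub>R d) - gradient f x" d]
    by (simp add: power2_eq_square mult.assoc)
  then have "gradient f (x + u *\<^sub>R d) \<bullet> d \<le> gradient f x \<bullet> d + L * t * (norm d)\<^sup>2"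
    by (simp add: inner_diff_left)
  then have "t * (gradient f (x + u *\<^sub>R d) \<bullet> d) \<le> t * (gradient f x \<bullet> d + L * t * (norm d)\<^sup>2)"
    using \<open>0 < t\<close> by (intro mult_left_mono) auto
  then show ?thesis
    using eq by (simp add: power2_eq_square algebra_simps)
qed

text \<open>The step length lies between 0 and 1, so the new point is a convex combination of
  \<open>x\<close> and its projected gradient point.\<close>

lemma pgls_mem_Xset:
  assumes "closed X" "convex X" "0 < \<delta>" "\<delta> < 1" "x \<in> Xset X y"
  shows "pgls X f \<gamma> \<delta> x y \<in> Xset X y"
proof -
  define p where "p = closest_point (Xset X y) (x - gradient f x)"
  obtain m where m: "pgls X f \<gamma> \<delta> x y = x + \<delta> ^ m *\<^sub>R (p - x)"
    unfolding pgls_def pg_direction_def p_def Let_def by blast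
  have "p \<in> Xset X y"
    unfolding p_def using assms(5) by (intro closest_point_in_set closed_Xset assms(1)) auto
  moreover have "0 \<le> \<delta> ^ m" "\<delta> ^ m \<le> 1"
    using assms by (auto intro: power_le_one)
  ultimately have "(1 - \<delta> ^ m) *\<^sub>R x + \<delta> ^ m *\<^sub>R p \<in> Xset X y"
    using assms(5) by (intro convexD[OF convex_Xset[OF assms(2)]]) auto
  then show ?thesis
    by (simp add: m algebra_simps)
qed

text \<open>Backtracking stops above a step length that depends only on \<open>L\<close>,
  \<open>\<gamma>\<close> and \<open>\<delta>\<close>. The factor is the same for all
  \<open>x\<close> and \<open>y\<close>, so the estimate survives a limit in
  \<open>x\<close>.\<close>

lemma pgls_sufficient_decrease:
  fixes X :: "(real ^ 'n) set"
  assumes "closed X" "convex X"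
    and diff: "\<And>z. f differentiable (at z)"
    and lip: "L-lipschitz_on UNIV (gradient f)"
    and "0 < \<gamma>" "\<gamma> < 1" "0 < \<delta>" "\<delta> < 1"
    and x: "x \<in> Xset X y"
  shows "\<gamma> * min 1 (\<delta> * (1 - \<gamma>) / (L + 1)) * (residual X f x y)\<^sup>2 \<le> f x - f (pgls X f \<gamma> \<delta> x y)"
proof -
  define d where "d = pg_direction X f x y"
  define P where "P m \<longleftrightarrow> f (x + \<delta> ^ m *\<^sub>R d) \<le> f x + \<gamma> * \<delta> ^ m * (gradient f x \<bullet> d)" for m
  \<comment> \<open>The value 1 covers an accepted full step. With \<open>L\<close> in place of
    \<open>L + 1\<close>, the case \<open>L = 0\<close> would divide by zero and make
    \<open>c\<close> zero.\<close>
  define c where "c = min 1 (\<delta> * (1 - \<gamma>) / (L + 1))"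
  have L: "0 \<le> L"
    using lip by (rule lipschitz_on_nonneg)
  have descent: "gradient f x \<bullet> d \<le> - (norm d)\<^sup>2"
    unfolding d_def by (rule pg_direction_descent[OF assms(1,2) x])
  have armijo: "P m" if "L * \<delta> ^ m \<le> 1 - \<gamma>" for m
  proof -
    have pos: "0 < \<delta> ^ m"
      using \<open>0 < \<delta>\<close> by simp
    have "L * \<delta> ^ m * (norm d)\<^sup>2 \<le> (1 - \<gamma>) * (norm d)\<^sup>2"
      using that by (rule mult_right_mono) simp
    also have "\<dots> \<le> (1 - \<gamma>) * (- (gradient f x \<bullet> d))"
      using descent \<open>\<gamma> < 1\<close> by (intro mult_left_mono) auto
    finally have "\<delta> ^ m * (L * \<delta> ^ m * (norm d)\<^sup>2) \<le> \<delta> ^ m * ((1 - \<gamma>) * (- (gradient f x \<bullet> d)))"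
      using pos by (intro mult_left_mono) auto
    then show ?thesis
      unfolding P_def using lipschitz_gradient_bound[OF diff lip pos, of x d]
      by (simp add: power2_eq_square algebra_simps)
  qed
  define m where "m = (LEAST m. P m)"
  \<comment> \<open>Short steps pass the test, so the \<open>LEAST\<close> in \<open>pgls\<close> is
    attained.\<close>
  have "(\<lambda>m. L * \<delta> ^ m) \<longlonglongrightarrow> 0"
    using LIMSEQ_realpow_zero[of \<delta>] assms by (intro tendsto_mult_right_zero) auto
  then have "\<forall>\<^sub>F m in sequentially. L * \<delta> ^ m < 1 - \<gamma>"
    using \<open>\<gamma> < 1\<close> by (intro order_tendstoD(2)[where y = 0]) auto
  then have "\<exists>m. P m"
    using armijo by (meson eventually_sequentially less_imp_le order_refl)
  then have Pm: "P m"
    unfolding m_def by (rule LeastI_ex)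
  \<comment> \<open>Either the full step is accepted, or the preceding trial
    \<open>\<delta> ^ j\<close> failed and was thus too long for \<open>armijo\<close>; the accepted
    step is shorter only by the factor \<open>\<delta>\<close>.\<close>
  have cm: "c \<le> \<delta> ^ m"
  proof (cases m)
    case 0
    then show ?thesis
      by (simp add: c_def)
  next
    case (Suc j)
    then have "\<not> P j"
      using not_less_Least[of j P] by (simp add: m_def)
    then have "1 - \<gamma> < L * \<delta> ^ j"
      using armijo by force
    also have "\<dots> \<le> (L + 1) * \<delta> ^ j"
      using \<open>0 < \<delta>\<close> by (intro mult_right_mono) auto
    finally have "\<delta> * (1 - \<gamma>) \<le> \<delta> * ((L + 1) * \<delta> ^ j)"
      using \<open>0 < \<delta>\<close> by (intro mult_left_mono) auto
    then have "\<delta> * (1 - \<gamma>) / (L + 1) \<le> \<delta> ^ m"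
      using L Suc by (simp add: divide_le_eq algebra_simps)
    then show ?thesis
      by (simp add: c_def min.coboundedI2)
  qed
  have "\<gamma> * c * (norm d)\<^sup>2 \<le> \<gamma> * \<delta> ^ m * (norm d)\<^sup>2"
    using cm \<open>0 < \<gamma>\<close> by (intro mult_right_mono mult_left_mono) auto
  also have "\<dots> \<le> \<gamma> * \<delta> ^ m * (- (gradient f x \<bullet> d))"
    using descent \<open>0 < \<gamma>\<close> \<open>0 < \<delta>\<close> by (intro mult_left_mono) auto
  also have "\<dots> \<le> f x - f (x + \<delta> ^ m *\<^sub>R d)"
    using Pm unfolding P_def by simp
  also have "x + \<delta> ^ m *\<^sub>R d = pgls X f \<gamma> \<delta> x y"
    unfolding pgls_def Let_def m_def P_def d_def ..
  finally show ?thesis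
    by (simp add: c_def d_def pg_direction_def residual_def norm_minus_commute)
qed

section \<open>Outcomes of the local search and feasibility of the iterates\<close>

lemma inner_search_mem_Xset:
  assumes "inner_search X f \<gamma> \<delta> target tol y' z out"
    and "closed X" "convex X" "0 < \<delta>" "\<delta> < 1"
    and "z \<in> Xset X y'" "out = Some z'"
  shows "z' \<in> Xset X y'"
  using assms(1,6,7)
  by (induction rule: inner_search.induct) (auto intro: pgls_mem_Xset[OF assms(2-5)])

text \<open>A discard may come after many inner steps, but both rules that allow the outcome
  \<open>None\<close> require that the step from \<open>z\<close> itself failed the test of Step
  2.3. Hence no induction.\<close>

lemma inner_search_None_rejects:
  assumes "inner_search X f \<gamma> \<delta> target tol y' z None"
  shows "target < f (pgls X f \<gamma> \<delta> z y')"
  using assms by cases auto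

lemma explore_Some:
  assumes "explore X f \<gamma> \<delta> target tol W out" "out = Some (z, y')"
  obtains x' where "(x', y') \<in> W" "inner_search X f \<gamma> \<delta> target tol y' x' (Some z)"
  using assms by (induction rule: explore.induct) auto

text \<open>The outcome \<open>None\<close> arises only at the empty set, and only discarded pairs
  are removed on the way there.\<close>

lemma explore_None:
  assumes "explore X f \<gamma> \<delta> target tol W out" "out = None" "(x', y') \<in> W"
  shows "inner_search X f \<gamma> \<delta> target tol y' x' None"
  using assms by (induction rule: explore.induct) auto

lemma trial_pair_feasible:
  assumes "closed X" "(x', y') \<in> trial_pairs X s f \<rho> \<xi> xt y"
  shows "y' \<in> Yset s" "x' \<in> Xset X y'"
  using assms(2)
  by (auto simp: trial_pairs_def neighborhood_def intro!: closest_point_in_set closed_Xset assms(1))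

lemma sns_step_feasible:
  assumes "sns_step X s f \<gamma> \<delta> \<rho> \<xi> \<theta> \<delta>' (x, y, \<eta>, \<mu>) (x', y', \<eta>', \<mu>')"
    and "closed X" "convex X" "0 < \<delta>" "\<delta> < 1"
    and "y \<in> Yset s" "x \<in> Xset X y"
  shows "y' \<in> Yset s \<and> x' \<in> Xset X y'"
  using assms(1)
proof cases
  case (improved xt)
  then obtain x'' where "(x'', y') \<in> trial_pairs X s f \<rho> \<xi> xt y"
    "inner_search X f \<gamma> \<delta> (f xt - \<eta>) (residual X f x y + \<mu>) y' x'' (Some x')"
    by (auto elim: explore_Some)
  then show ?thesis
    using trial_pair_feasible[OF assms(2)] inner_search_mem_Xset[OF _ assms(2-5) _ refl] by metis
next
  case not_improved
  then show ?thesis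
    using assms(6,7) pgls_mem_Xset[OF assms(2-5)] by simp
qed

lemma sns_sequence_feasible:
  assumes "sns_sequence X s f \<gamma> \<delta> \<rho> \<xi> \<theta> \<delta>' x y \<eta> \<mu>"
    and "closed X" "convex X" "0 < \<delta>" "\<delta> < 1"
    and "y 0 \<in> Yset s" "x 0 \<in> Xset X (y 0)"
  shows "y k \<in> Yset s \<and> x k \<in> Xset X (y k)"
proof (induction k)
  case 0
  then show ?case
    using assms by simp
next
  case (Suc k)
  then show ?case
    using assms(1) sns_step_feasible[OF _ assms(2-5)] unfolding sns_sequence_def by blast
qed

section \<open>Decrease of the thresholds \<open>\<eta>\<close>\<close>

lemma sns_step_eta:
  assumes "sns_step X s f \<gamma> \<delta> \<rho> \<xi> \<theta> \<delta>' (x, y, \<eta>, \<mu>) (x', y', \<eta>', \<mu>')"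
  shows "\<eta>' = \<eta> \<or> \<eta>' = \<theta> * \<eta>"
  using assms by cases auto

text \<open>Only Step 3 can lower \<open>\<eta>\<close>. The new point is then the PGLS point, so
  \<open>x'\<close> can replace it in the target and in the trial pairs.\<close>

lemma sns_step_eta_decreased:
  assumes "sns_step X s f \<gamma> \<delta> \<rho> \<xi> \<theta> \<delta>' (x, y, \<eta>, \<mu>) (x', y', \<eta>', \<mu>')" "\<eta>' < \<eta>"
  shows "y' = y"
    and "explore X f \<gamma> \<delta> (f x' - \<eta>) (residual X f x y + \<mu>) (trial_pairs X s f \<rho> \<xi> x' y) None"
  using assms by (cases; auto)+

text \<open>Each index \<open>q m\<close> contributes one factor \<open>\<theta>\<close>, and
  \<open>\<eta>\<close> never increases in between.\<close>

lemma geometric_decrease_tendsto_0: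
  fixes \<eta> :: "nat \<Rightarrow> real"
  assumes "0 < \<theta>" "\<theta> < 1" "0 < \<eta> 0"
    and step: "\<And>k. \<eta> (Suc k) = \<eta> k \<or> \<eta> (Suc k) = \<theta> * \<eta> k"
    and q: "strict_mono q" "\<And>m. \<eta> (Suc (q m)) < \<eta> (q m)"
  shows "(\<lambda>m. \<eta> (q m)) \<longlonglongrightarrow> 0"
proof -
  have pos: "0 < \<eta> k" for k
  proof (induction k)
    case (Suc k)
    then show ?case
      using step[of k] \<open>0 < \<theta>\<close> by auto
  qed (use assms in simp)
  have "\<eta> (Suc k) \<le> \<eta> k" for k
    using step[of k] pos[of k] \<open>\<theta> < 1\<close> by auto
  then have anti: "decseq \<eta>"
    by (rule decseq_SucI)
  have "\<eta> (q m) \<le> \<theta> ^ m * \<eta> 0" for m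
  proof (induction m)
    case 0
    show ?case
      using decseqD[OF anti, of 0 "q 0"] by simp
  next
    case (Suc m)
    have "\<eta> (q (Suc m)) \<le> \<eta> (Suc (q m))"
      using q(1) by (intro decseqD[OF anti]) (simp add: strict_mono_Suc_iff Suc_leI)
    also have "\<dots> = \<theta> * \<eta> (q m)"
      using step[of "q m"] q(2)[of m] by auto
    also have "\<dots> \<le> \<theta> * (\<theta> ^ m * \<eta> 0)"
      using Suc.IH \<open>0 < \<theta>\<close> by (intro mult_left_mono) auto
    finally show ?case
      by simp
  qed
  then have "\<forall>\<^sub>F m in sequentially. norm (\<eta> (q m)) \<le> \<theta> ^ m * \<eta> 0"
    using pos by (simp add: abs_of_pos)
  moreover have "(\<lambda>m. \<theta> ^ m * \<eta> 0) \<longlonglongrightarrow> 0"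
    using assms by (intro tendsto_mult_left_zero LIMSEQ_realpow_zero) auto
  ultimately show ?thesis
    by (rule Lim_null_comparison)
qed

section \<open>Super supports and zero patterns\<close>

lemma Yset_card_zeros:
  fixes y :: "real ^ 'n"
  assumes "y \<in> Yset s"
  shows "card {i. y $ i = 0} \<le> s"
proof -
  have "1 \<bullet> y = (\<Sum>i\<in>UNIV. 1 - of_bool (y $ i = 0))"
    using assms by (auto simp: Yset_def inner_vec_def intro!: sum.cong)
  also have "\<dots> = real CARD('n) - real (card {i. y $ i = 0})"
    by (simp add: sum_subtractf)
  finally show ?thesis
    using assms by (simp add: Yset_def)
qed

lemma super_support_mem_Yset:
  fixes x :: "real ^ 'n"
  assumes "super_support s x J"
  shows "(\<chi> i. if i \<in> J then 0 else 1) \<in> Yset s"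
proof -
  have "(\<Sum>i\<in>UNIV. if i \<in> J then 0 else 1 :: real) = (\<Sum>i\<in>UNIV. 1 - of_bool (i \<in> J))"
    by (auto intro!: sum.cong)
  also have "\<dots> = real CARD('n) - real s"
    using assms by (simp add: sum_subtractf super_support_def)
  finally show ?thesis
    by (simp add: Yset_def inner_vec_def)
qed

lemma Xset_zeros:
  assumes "x \<in> Xset X y"
  shows "{i. x $ i \<noteq> 0} \<subseteq> {i. y $ i = 0}"
  using assms by (auto simp: Xset_def)

text \<open>Both patterns are 0 on the support of \<open>x\<close> and 1 outside \<open>J\<close>
  and \<open>?Z\<close>. They can differ only on the parts of \<open>J\<close> and \<open>?Z\<close>
  outside the support, each of size at most \<open>s - norm0 x\<close>.\<close>

lemma super_support_hamming_dist:
  fixes x :: "real ^ 'n"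
  assumes "super_support s x J" "y \<in> Yset s" "x \<in> Xset X y"
  shows "hamming_dist (\<chi> i. if i \<in> J then 0 else 1) y \<le> 2 * (s - norm0 x)"
proof -
  let ?S = "{i. x $ i \<noteq> 0}" and ?Z = "{i. y $ i = 0}"
  have y01: "y $ i = 0 \<or> y $ i = 1" for i
    using assms(2) by (auto simp: Yset_def)
  have SJ: "?S \<subseteq> J" and SZ: "?S \<subseteq> ?Z"
    using assms Xset_zeros by (auto simp: super_support_def)
  have "diff_indices (\<chi> i. if i \<in> J then 0 else 1) y \<subseteq> (J - ?S) \<union> (?Z - ?S)"
    using SJ SZ y01 by (fastforce simp: diff_indices_def split: if_splits)
  then have "hamming_dist (\<chi> i. if i \<in> J then 0 else 1) y \<le> card ((J - ?S) \<union> (?Z - ?S))"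
    unfolding hamming_dist_def by (intro card_mono) auto
  also have "\<dots> \<le> card (J - ?S) + card (?Z - ?S)"
    by (rule card_Un_le)
  also have "\<dots> = (card J - norm0 x) + (card ?Z - norm0 x)"
    using SJ SZ by (simp add: card_Diff_subset norm0_def)
  also have "\<dots> \<le> 2 * (s - norm0 x)"
    using assms(1) Yset_card_zeros[OF assms(2)] by (simp add: super_support_def)
  finally show ?thesis .
qed

lemma super_support_mem_Xset:
  assumes "super_support s x J" "x \<in> X"
  shows "x \<in> Xset X (\<chi> i. if i \<in> J then 0 else 1)"
  using assms by (auto simp: super_support_def Xset_def)

text \<open>Where the patterns differ, one of them is nonzero and forces that component of
  \<open>x\<close> to vanish already.\<close>

lemma zero_out_super_support:
  assumes "super_support s x J" "x \<in> Xset X y"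
  shows "zero_out (diff_indices y (\<chi> i. if i \<in> J then 0 else 1)) x = x"
  using assms by (auto simp: zero_out_def diff_indices_def super_support_def Xset_def vec_eq_iff)

lemma tendsto_zero_out:
  assumes "(g \<longlongrightarrow> l) F"
  shows "((\<lambda>m. zero_out J (g m)) \<longlongrightarrow> zero_out J l) F"
  unfolding zero_out_def using assms by (intro tendsto_vec_lambda) (auto intro: tendsto_vec_nth)

text \<open>Points of \<open>Xset X yJ\<close> vanish outside \<open>J\<close>, so differences of
  such points meet only the \<open>J\<close>-components of the gradient. The full and the truncated
  step therefore give the same variational inequality.\<close>

lemma stationary_imp_truncated_stationary:
  fixes x :: "real ^ 'n"
  assumes "closed X" "convex X" "super_support s x J"
  defines "yJ \<equiv> \<chi> i. if i \<in> J then 0 else 1"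
  assumes x: "x \<in> Xset X yJ" and stationary: "closest_point (Xset X yJ) (x - gradient f x) = x"
  shows "x = closest_point (Xset X yJ) (x + (\<chi> i. if i \<in> J then - (1 / 1) * gradient f x $ i else 0))"
    (is "_ = closest_point _ (x + ?d)")
proof (rule closest_point_unique[OF convex_Xset[OF assms(2)] closed_Xset[OF assms(1)] x])
  show "\<forall>z\<in>Xset X yJ. dist (x + ?d) x \<le> dist (x + ?d) z"
  proof
    \<comment> \<open>This turns the variational inequality back into minimality of the
      distance.\<close>
    have obtuse: "norm a \<le> norm (a - b)" if "a \<bullet> b \<le> 0" for a b :: "real ^ 'n"
      unfolding norm_le inner_diff using that inner_ge_zero[of b] inner_commute[of a b] by linarith
    fix z assume z: "z \<in> Xset X yJ"
    have "(x - gradient f x - x) \<bullet> (z - x) \<le> 0"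
      using closest_point_dot[OF convex_Xset[OF assms(2)] closed_Xset[OF assms(1)] z] stationary by metis
    moreover have "z $ i = 0" "x $ i = 0" if "i \<notin> J" for i
      using z x that by (auto simp: Xset_def yJ_def dest!: spec[of _ i])
    then have "?d \<bullet> (z - x) = (x - gradient f x - x) \<bullet> (z - x)"
      by (auto simp: inner_vec_def intro!: sum.cong)
    ultimately have "?d \<bullet> (z - x) \<le> 0"
      by simp
    then have "norm ?d \<le> norm (?d - (z - x))"
      by (rule obtuse)
    then show "dist (x + ?d) x \<le> dist (x + ?d) z"
      by (simp add: dist_norm algebra_simps)
  qed
qed

section \<open>Passage to the limit along \<open>Ku\<close>\<close>

theorem theorem3p12:
  fixes X :: "(real ^ 'n) set"
    and f :: "real ^ 'n \<Rightarrow> real"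
    and s \<rho> :: nat
    and \<gamma> \<delta> \<xi> \<theta> \<delta>' :: real
    and x y :: "nat \<Rightarrow> real ^ 'n"
    and \<eta> \<mu> :: "nat \<Rightarrow> real"
    and Ku :: "nat set"
    and Acc :: "((real ^ 'n) \<times> (real ^ 'n)) set"
    and \<delta>min :: nat
  assumes "s < CARD('n)"
    and "closed X" and "convex X"
    and "\<forall>z. f differentiable (at z)"
    and "continuous_on UNIV (gradient f)"
    and "\<exists>L. L-lipschitz_on UNIV (gradient f)"
    and "0 < \<gamma>" "\<gamma> < 1 / 2"
    and "0 < \<delta>" "\<delta> < 1"
    and "0 < \<xi>"
    and "0 < \<theta>" "\<theta> < 1"
    and "0 < \<delta>'" "\<delta>' < 1"
    and "0 < \<eta> 0" "0 < \<mu> 0"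
    and "y 0 \<in> Yset s" and "x 0 \<in> Xset X (y 0)"
    and "sns_sequence X s f \<gamma> \<delta> \<rho> \<xi> \<theta> \<delta>' x y \<eta> \<mu>"
    and "compact {(a, b). b \<in> Yset s \<and> a \<in> Xset X b \<and> f a \<le> f (x 0) + \<xi>}"
    and "Ku = {k. k \<ge> 1 \<and> \<eta> k < \<eta> (k - 1)}"
    and "Acc = accumulation_points Ku x y"
    and "\<delta>min = Min {norm0 xs |xs ys. (xs, ys) \<in> Acc}"
    and "int \<rho> \<ge> 2 * (int s - int \<delta>min)"
  shows "\<forall>(xs, ys) \<in> Acc. basic_feasible X s f xs"
proof (safe)
  fix xs ys
  assume acc: "(xs, ys) \<in> Acc"
  note X = \<open>closed X\<close> \<open>convex X\<close>
  have diff: "\<And>z. f differentiable (at z)"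
    using assms by blast
  obtain L where lip: "L-lipschitz_on UNIV (gradient f)"
    using assms by blast
  have L: "0 \<le> L"
    using lip by (rule lipschitz_on_nonneg)
  have f_cont: "continuous_on UNIV f"
    using diff by (auto intro!: differentiable_imp_continuous_on simp: differentiable_on_def differentiable_at_withinI)
  have step: "sns_step X s f \<gamma> \<delta> \<rho> \<xi> \<theta> \<delta>' (x k, y k, \<eta> k, \<mu> k)
      (x (Suc k), y (Suc k), \<eta> (Suc k), \<mu> (Suc k))" for k
    using \<open>sns_sequence X s f \<gamma> \<delta> \<rho> \<xi> \<theta> \<delta>' x y \<eta> \<mu>\<close> by (simp add: sns_sequence_def)
  have feas: "y k \<in> Yset s \<and> x k \<in> Xset X (y k)" for k
    using assms by (intro sns_sequence_feasible)
  obtain r :: "nat \<Rightarrow> nat" where r: "strict_mono r" "range r \<subseteq> Ku"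
    and xr: "(\<lambda>m. x (r m)) \<longlonglongrightarrow> xs" and yr: "\<forall>\<^sub>F m in sequentially. y (r m) = ys"
    using acc \<open>Acc = accumulation_points Ku x y\<close> unfolding accumulation_points_def by auto
  \<comment> \<open>Iteration \<open>q m\<close> is the one that produces index \<open>r m\<close>.
    Indices in \<open>Ku\<close> are at least 1, so the truncated subtraction loses nothing.\<close>
  define q where "q m = r m - 1" for m
  have rKu: "r m \<in> Ku" for m
    using r(2) by blast
  have q: "r m = Suc (q m)" "\<eta> (Suc (q m)) < \<eta> (q m)" for m
    using rKu[of m] unfolding \<open>Ku = _\<close> by (simp_all add: q_def)
  have q_mono: "strict_mono q"
    using r(1) by (simp add: strict_mono_Suc_iff q(1))
  have eta0: "(\<lambda>m. \<eta> (q m)) \<longlonglongrightarrow> 0"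
    using \<open>0 < \<theta>\<close> \<open>\<theta> < 1\<close> \<open>0 < \<eta> 0\<close> sns_step_eta[OF step] q_mono q(2)
    by (rule geometric_decrease_tendsto_0)
  have ysY: "ys \<in> Yset s"
    using eventually_happens[OF yr] feas by auto
  have "\<forall>\<^sub>F m in sequentially. x (r m) \<in> Xset X ys"
    using yr by eventually_elim (use feas in metis)
  then have xsX: "xs \<in> Xset X ys"
    using xr by (intro Lim_in_closed_set[OF closed_Xset[OF X(1)] _ _ xr]) auto
  have xs_in: "xs \<in> X"
    using xsX by (simp add: Xset_def)
  have xs_s: "norm0 xs \<le> s"
    unfolding norm0_def
    using card_mono[OF _ Xset_zeros[OF xsX]] Yset_card_zeros[OF ysY] by simp
  \<comment> \<open>\<open>Acc\<close> may be infinite, but \<open>norm0\<close> takes finitely many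
    values, so \<open>Min\<close> is a genuine lower bound.\<close>
  have "finite {norm0 xs |xs ys. (xs, ys) \<in> Acc}"
    by (rule finite_subset[of _ "{..CARD('n)}"]) (auto simp: norm0_def intro: card_mono)
  then have "\<delta>min \<le> norm0 xs"
    unfolding \<open>\<delta>min = _\<close> using acc by (intro Min_le) auto
  then have rho: "2 * (s - norm0 xs) \<le> \<rho>"
    using \<open>int \<rho> \<ge> _\<close> xs_s by arith
  show "basic_feasible X s f xs"
    unfolding basic_feasible_def
  proof (intro conjI allI impI xs_in xs_s exI[of _ "1 :: real"])
    fix J assume J: "super_support s xs J"
    define yJ :: "real ^ 'n" where "yJ = (\<chi> i. if i \<in> J then 0 else 1)"
    have xsJ: "xs \<in> Xset X yJ"
      unfolding yJ_def by (rule super_support_mem_Xset[OF J xs_in])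
    note XJ = convex_Xset[OF X(2), of yJ] closed_Xset[OF X(1), of yJ]
    \<comment> \<open>Using \<open>ys\<close> instead of \<open>y (q m)\<close>, which eventually
      agrees with it, makes \<open>p m\<close> the image of \<open>x (r m)\<close> under one fixed
      continuous map.\<close>
    define p where "p m = closest_point (Xset X yJ) (zero_out (diff_indices ys yJ) (x (r m)))" for m
    have cp_cont: "continuous_on UNIV (closest_point (Xset X yJ))"
      using XJ xsJ by (intro continuous_on_closest_point) auto
    have pX: "p m \<in> Xset X yJ" for m
      unfolding p_def using XJ xsJ by (intro closest_point_in_set) auto
    have "(\<lambda>m. zero_out (diff_indices ys yJ) (x (r m))) \<longlonglongrightarrow> xs"
      using tendsto_zero_out[OF xr, of "diff_indices ys yJ"] zero_out_super_support[OF J xsX]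
      by (simp add: yJ_def)
    then have "p \<longlonglongrightarrow> closest_point (Xset X yJ) xs"
      unfolding p_def by (rule continuous_on_tendsto_compose[OF cp_cont]) auto
    then have p_lim: "p \<longlonglongrightarrow> xs"
      using closest_point_self[OF xsJ] by simp
    have fp: "(\<lambda>m. f (p m)) \<longlonglongrightarrow> f xs"
      by (rule continuous_on_tendsto_compose[OF f_cont p_lim]) auto
    have fx: "(\<lambda>m. f (x (r m))) \<longlonglongrightarrow> f xs"
      by (rule continuous_on_tendsto_compose[OF f_cont xr]) auto
    \<comment> \<open>This secures the bound by \<open>\<xi>\<close> required of trial
      pairs.\<close>
    have "(\<lambda>m. f (p m) - f (x (r m))) \<longlonglongrightarrow> 0"
      using tendsto_diff[OF fp fx] by simp
    then have near: "\<forall>\<^sub>F m in sequentially. f (p m) - f (x (r m)) < \<xi>"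
      using \<open>0 < \<xi>\<close> by (rule order_tendstoD(2))
    have rejected: "\<forall>\<^sub>F m in sequentially. f (x (r m)) - \<eta> (q m) < f (pgls X f \<gamma> \<delta> (p m) yJ)"
      using near yr
    proof eventually_elim
      case (elim m)
      \<comment> \<open>A step that lowers \<open>\<eta>\<close> keeps the pattern, so the one at
        \<open>r m\<close> was already present at \<open>q m\<close>.\<close>
      have yq: "y (q m) = ys"
        using sns_step_eta_decreased(1)[OF step q(2)[of m]] elim(2) by (simp add: q(1))
      have "(p m, yJ) \<in> trial_pairs X s f \<rho> \<xi> (x (r m)) (y (q m))"
        unfolding trial_pairs_def neighborhood_def yq
        using elim(1) xsJ super_support_mem_Yset[OF J] rho
          super_support_hamming_dist[OF J ysY xsX]
        by (auto simp: p_def yJ_def)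
      then have "inner_search X f \<gamma> \<delta> (f (x (r m)) - \<eta> (q m))
          (residual X f (x (q m)) (y (q m)) + \<mu> (q m)) yJ (p m) None"
        using explore_None[OF sns_step_eta_decreased(2)[OF step q(2)[of m]] refl] by (simp add: q(1))
      then show ?case
        by (rule inner_search_None_rejects)
    qed
    define c where "c = \<gamma> * min 1 (\<delta> * (1 - \<gamma>) / (L + 1))"
    have c: "0 < c"
      using assms L by (simp add: c_def)
    have res_bound: "\<forall>\<^sub>F m in sequentially.
        c * (residual X f (p m) yJ)\<^sup>2 \<le> f (p m) - f (x (r m)) + \<eta> (q m)"
      using rejected
    proof eventually_elim
      case (elim m)
      have "c * (residual X f (p m) yJ)\<^sup>2 \<le> f (p m) - f (pgls X f \<gamma> \<delta> (p m) yJ)"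
        unfolding c_def using assms lip pX by (intro pgls_sufficient_decrease) auto
      then show ?case
        using elim by linarith
    qed
    have "continuous_on UNIV (\<lambda>z. residual X f z yJ)"
      unfolding residual_def
      using \<open>continuous_on UNIV (gradient f)\<close>
      by (intro continuous_intros continuous_on_compose2[OF cp_cont]) auto
    then have "(\<lambda>m. residual X f (p m) yJ) \<longlonglongrightarrow> residual X f xs yJ"
      by (rule continuous_on_tendsto_compose[OF _ p_lim]) auto
    then have "(\<lambda>m. c * (residual X f (p m) yJ)\<^sup>2) \<longlonglongrightarrow> c * (residual X f xs yJ)\<^sup>2"
      by (intro tendsto_intros)
    moreover have "(\<lambda>m. f (p m) - f (x (r m)) + \<eta> (q m)) \<longlonglongrightarrow> 0"
      using tendsto_add[OF tendsto_diff[OF fp fx] eta0] by simp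
    \<comment> \<open>The eventual inequality \<open>res_bound\<close> passes to the limits of both
      sides.\<close>
    ultimately have "c * (residual X f xs yJ)\<^sup>2 \<le> 0"
      using res_bound by (intro tendsto_le[OF sequentially_bot])
    then have "(residual X f xs yJ)\<^sup>2 \<le> 0"
      using c by (simp add: mult_le_0_iff)
    then have "closest_point (Xset X yJ) (xs - gradient f xs) = xs"
      by (simp add: residual_def)
    then show "xs = closest_point (Xset X (\<chi> i. if i \<in> J then 0 else 1))
        (xs + (\<chi> i. if i \<in> J then - (1 / 1) * gradient f xs $ i else 0))"
      using stationary_imp_truncated_stationary[OF X J] xsJ unfolding yJ_def by blast
  qed simp
qed

end
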